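(* Let $m,n\ge 2$, let $G_1$ be a connected closed graph on $[m]$ and $G_2$ a connected closed graph on $[n]$. Let $G$ be the graph on the vertex set $[m+n-2]$ associated to the pair $(G_1,G_2)$, i.e. with edge set $$E(G)=\{\{i+k-1,\,j+l-2\} : i<j,\ k<l,\ \{i,j\}\in E(G_1),\ \{k,l\}\in E(G_2)\}.$$ Then $G$ is a connected closed graph and $I_{G_1,G_2}=I_G$ as ideals of $S=K[x_1,\ldots,x_{m+n-1}]$.
   Context: $K$ is a field, $[n]=\{1,\ldots,n\}$, and all graphs are finite and simple. A graph $H$ on $[n]$ is closed if there is a labeling of its vertices such that whenever $1\le i<j<k\le n$ or $1\le k<j<i\le n$ and $\{i,j\},\{i,k\}\in E(H)$, then $\{j,k\}\in E(H)$. For connected $H$ this is equivalent to the existence of a labeling for which all maximal cliques are intervals $[a,b]=\{a,a+1,\ldots,b\}\subset[n]$ (equivalently, if $\{i,j\}\in E(H)$ and $i<k<j$ then $\{i,k\},\{k,j\}\in E(H)$). Convention: a closed graph on $[n]$ is always labeled so that its maximal cliques are intervals $F_i=[a_i,b_i]$, $1\le i\le r$, with $1=a_1<a_2<\cdots<a_r<b_r=n$. In particular "closed" refers to the given labeling by $[n]$. Let $X=(x_{ij})$, $1\le i\le m$, $1\le j\le n$, be the generic Hankel matrix with $x_{ij}=x_{i+j-1}$, and $S=K[x_1,\ldots,x_{m+n-1}]$. The Hankel ideal $I_{G_1,G_2}\subset S$ is the ideal generated by the $2$-minors $$g_{e,f}=x_{i+k-1}x_{j+l-1}-x_{j+k-1}x_{i+l-1},\qquad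 e=\{i,j\}\in E(G_1),\ i<j,\quad f=\{k,l\}\in E(G_2),\ k<l.$$ For a graph $H$ on $[N]$, the scroll binomial edge ideal is $$I_H=(x_px_{q+1}-x_{p+1}x_q : p<q,\ \{p,q\}\in E(H))\subset K[x_1,\ldots,x_{N+1}];$$ for $H=G$ on $[m+n-2]$ this is an ideal of $S$. *)

theory Defs
  imports "HOL-Library.Poly_Mapping" "HOL-Library.Ramsey" "HOL-Algebra.Ideal"
begin

section \<open>Graphs on \<open>[n]\<close>\<close>

text \<open>A finite simple graph on \<open>[n]\<close> is given by its set of edges, each a two-element subset
  of \<open>{1..n}\<close>.\<close>

definition graph_on :: "nat \<Rightarrow> nat set set \<Rightarrow> bool" where
  "graph_on n E \<longleftrightarrow> E \<subseteq> nsets {1..n} 2"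

definition connected_graph :: "nat \<Rightarrow> nat set set \<Rightarrow> bool" where
  "connected_graph n E \<longleftrightarrow> (\<forall>u\<in>{1..n}. \<forall>v\<in>{1..n}. (u, v) \<in> {(x, y). {x, y} \<in> E}\<^sup>*)"

definition closed_labeling :: "nat \<Rightarrow> nat set set \<Rightarrow> (nat \<Rightarrow> nat) \<Rightarrow> bool" where
  "closed_labeling n E \<sigma> \<longleftrightarrow> bij_betw \<sigma> {1..n} {1..n} \<and>
     (\<forall>u\<in>{1..n}. \<forall>v\<in>{1..n}. \<forall>w\<in>{1..n}.
        (\<sigma> u < \<sigma> v \<and> \<sigma> v < \<sigma> w \<or> \<sigma> w < \<sigma> v \<and> \<sigma> v < \<sigma> u) \<longrightarrow>
        {u, v} \<in> E \<longrightarrow> {u, w} \<in> E \<longrightarrow> {v, w} \<in> E)"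

definition maximal_cliques :: "nat \<Rightarrow> nat set set \<Rightarrow> nat set set" where
  "maximal_cliques n E =
     {C. C \<subseteq> {1..n} \<and> clique C E \<and> (\<forall>D. D \<subseteq> {1..n} \<and> clique D E \<and> C \<subseteq> D \<longrightarrow> D = C)}"

text \<open>The given labeling by \<open>[n]\<close> makes the maximal cliques the intervals
  \<open>F\<^sub>i = [a\<^sub>i, b\<^sub>i]\<close>, \<open>1 \<le> i \<le> r\<close>, with \<open>1 = a\<^sub>1 < \<dots> < a\<^sub>r < b\<^sub>r = n\<close>.\<close>

definition interval_labeled :: "nat \<Rightarrow> nat set set \<Rightarrow> bool" where
  "interval_labeled n E \<longleftrightarrow>
     (\<exists>(r::nat) a b. 1 \<le> r \<and> maximal_cliques n E = (\<lambda>i. {a i..b i}) ` {1..r} \<and>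
        a 1 = 1 \<and> strict_mono_on {1..r} a \<and> a r < b r \<and> b r = n)"

text \<open>Closedness is the existence of some closed labeling; by convention a closed graph moreover
  always carries a labeling of the above interval form, so that being a closed graph on \<open>[n]\<close> is a
  condition on the given labeling.\<close>

definition closed_graph :: "nat \<Rightarrow> nat set set \<Rightarrow> bool" where
  "closed_graph n E \<longleftrightarrow> (\<exists>\<sigma>. closed_labeling n E \<sigma>) \<and> interval_labeled n E"

definition pair_graph :: "nat set set \<Rightarrow> nat set set \<Rightarrow> nat set set" where
  "pair_graph E1 E2 =
     {{i + k - 1, j + l - 2} | i j k l. i < j \<and> k < l \<and> {i, j} \<in> E1 \<and> {k, l} \<in> E2}"


section \<open>Polynomial rings and ideals\<close>

text \<open>A polynomial maps exponent vectors, themselves finitely supported maps from variable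
  indices to exponents, to coefficients. The ring \<open>K[x\<^sub>1, \<dots>, x\<^sub>N]\<close> consists of those polynomials
  involving no variables other than \<open>x\<^sub>1, \<dots>, x\<^sub>N\<close>.\<close>

type_synonym 'k mpoly = "(nat \<Rightarrow>\<^sub>0 nat) \<Rightarrow>\<^sub>0 'k"

definition X :: "nat \<Rightarrow> 'k::field mpoly" where
  "X i = Poly_Mapping.single (Poly_Mapping.single i 1) 1"

definition poly_ring :: "nat \<Rightarrow> 'k::field mpoly ring" where
  "poly_ring N =
     \<lparr>carrier = {p. \<forall>t\<in>Poly_Mapping.keys p. Poly_Mapping.keys t \<subseteq> {1..N}},
      mult = (*), one = 1, zero = 0, add = (+)\<rparr>"

definition hankel :: "nat \<Rightarrow> nat \<Rightarrow> 'k::field mpoly" where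
  "hankel i j = X (i + j - 1)"

definition hankel_ideal ::
    "nat \<Rightarrow> nat \<Rightarrow> nat set set \<Rightarrow> nat set set \<Rightarrow> 'k::field mpoly set" where
  "hankel_ideal m n E1 E2 =
     Idl\<^bsub>poly_ring (m + n - 1)\<^esub>
       {hankel i k * hankel j l - hankel j k * hankel i l | i j k l.
          i < j \<and> k < l \<and> {i, j} \<in> E1 \<and> {k, l} \<in> E2}"

definition scroll_ideal :: "nat \<Rightarrow> nat set set \<Rightarrow> 'k::field mpoly set" where
  "scroll_ideal N E =
     Idl\<^bsub>poly_ring (N + 1)\<^esub> {X p * X (q + 1) - X (p + 1) * X q | p q. p < q \<and> {p, q} \<in> E}"

lemma carrier_poly_ring:
  "p \<in> carrier (poly_ring N) \<longleftrightarrow>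
    (\<forall>t. t \<in> Poly_Mapping.keys p \<longrightarrow> Poly_Mapping.keys t \<subseteq> {1..N})"
  by (auto simp: poly_ring_def)

lemma poly_ring_sel:
  "x \<otimes>\<^bsub>poly_ring N\<^esub> y = x * y" "\<one>\<^bsub>poly_ring N\<^esub> = 1"
  "x \<oplus>\<^bsub>poly_ring N\<^esub> y = x + y" "\<zero>\<^bsub>poly_ring N\<^esub> = 0"
  by (simp_all add: poly_ring_def)

lemma cring_poly_ring: "cring (poly_ring N :: 'k::field mpoly ring)"
proof -
  let ?R = "poly_ring N :: 'k mpoly ring"
  have add: "p + q \<in> carrier ?R" if "p \<in> carrier ?R" "q \<in> carrier ?R" for p q
    using that Poly_Mapping.keys_add[of p q] unfolding carrier_poly_ring by blast
  have mult: "p * q \<in> carrier ?R" if p: "p \<in> carrier ?R" and q: "q \<in> carrier ?R" for p q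
    unfolding carrier_poly_ring
  proof (intro allI impI)
    fix t assume "t \<in> Poly_Mapping.keys (p * q)"
    then obtain u v where t: "t = u + v"
      and uv: "u \<in> Poly_Mapping.keys p" "v \<in> Poly_Mapping.keys q"
      using keys_mult[of p q] by blast
    have "Poly_Mapping.keys u \<subseteq> {1..N}" "Poly_Mapping.keys v \<subseteq> {1..N}"
      using uv p q unfolding carrier_poly_ring by blast+
    then show "Poly_Mapping.keys t \<subseteq> {1..N}"
      unfolding t using Poly_Mapping.keys_add[of u v] by blast
  qed
  have keys_neg: "Poly_Mapping.keys (- p) = Poly_Mapping.keys p" for p :: "'k mpoly"
    by (simp only: set_eq_iff in_keys_iff lookup_uminus neg_equal_0_iff_equal simp_thms)
  have neg: "- p \<in> carrier ?R" if "p \<in> carrier ?R" for p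
    using that unfolding carrier_poly_ring keys_neg .
  have zero: "0 \<in> carrier ?R" and one: "1 \<in> carrier ?R"
    unfolding carrier_poly_ring by simp_all
  have "abelian_group ?R"
    by (rule abelian_groupI; unfold poly_ring_sel)
      (auto intro: add zero rev_bexI[OF neg] simp: add.assoc add.commute)
  moreover have "Group.comm_monoid ?R"
    by (rule comm_monoidI; unfold poly_ring_sel)
      (auto intro: mult one simp: mult.assoc mult.commute)
  ultimately show ?thesis
    by (rule cringI; unfold poly_ring_sel) (rule distrib_right)
qed

lemma X_in_poly_ring: "1 \<le> i \<Longrightarrow> i \<le> N \<Longrightarrow> X i \<in> carrier (poly_ring N)"
  unfolding carrier_poly_ring X_def by simp

end

theory Submission
  imports Defs "HOL-Library.Infinite_Set"
begin

text \<open>Call a graph convex if with every edge \<open>{p, q}\<close> it contains all pairs inside \<open>[p, q]\<close>.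
  For a graph on \<open>[N]\<close>, \<open>N \<ge> 2\<close>, being connected and having the intervals \<open>[a\<^sub>i, b\<^sub>i]\<close>
  as its maximal cliques amounts to being convex and containing all edges \<open>{i, i + 1}\<close>. Both
  properties pass from the two given graphs to \<open>G\<close>: an edge \<open>{i + k - 1, j + l - 2}\<close> of \<open>G\<close> that
  is longer than one step comes from edges \<open>{i, j}\<close> and \<open>{k, l}\<close> of which at least one is longer
  than one step too and can be shortened at either end.

  For the ideals, let \<open>p = i + k - 1\<close> and \<open>q = j + l - 2\<close>. The minor given by \<open>{i, j}\<close> and
  \<open>{k, l}\<close> is \<open>x\<^sub>p x\<^sub>q\<^sub>+\<^sub>1 - x\<^sub>u x\<^sub>v\<close> where \<open>u\<close> and \<open>v\<close> lie strictly between \<open>p\<close> and \<open>q + 1\<close> and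
  \<open>u + v = p + q + 1\<close>. Moving the two indices towards each other one step at a time writes such a
  difference as a telescoping sum of the scroll binomials of \<open>{p, q}\<close>, \<open>{p + 1, q - 1}\<close>,
  \<open>{p + 2, q - 2}\<close> and so on, which are edges by convexity (\<open>telescoping_binomial\<close>). So the minors
  lie in the scroll ideal. Conversely, the first summand is the scroll binomial of \<open>{p, q}\<close>
  itself and all others belong to shorter edges of \<open>G\<close>; by induction on \<open>q - p\<close> every scroll
  binomial lies in the Hankel ideal (\<open>scroll_binomial_in_hankel_ideal\<close>).\<close>

section \<open>Convex graphs\<close>

definition convex_graph :: "nat set set \<Rightarrow> bool" where
  "convex_graph E \<longleftrightarrow> (\<forall>p q k l. {p, q} \<in> E \<longrightarrow> p \<le> k \<longrightarrow> k < l \<longrightarrow> l \<le> q \<longrightarrow> {k, l} \<in> E)"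

lemma convex_graphD:
  "convex_graph E \<Longrightarrow> {p, q} \<in> E \<Longrightarrow> p \<le> k \<Longrightarrow> k < l \<Longrightarrow> l \<le> q \<Longrightarrow> {k, l} \<in> E"
  unfolding convex_graph_def by blast

lemma convex_graphI_shorten:
  assumes left: "\<And>p q. {p, q} \<in> E \<Longrightarrow> p + 1 < q \<Longrightarrow> {p + 1, q} \<in> E"
    and right: "\<And>p q. {p, q} \<in> E \<Longrightarrow> p + 1 < q \<Longrightarrow> {p, q - 1} \<in> E"
  shows "convex_graph E"
proof -
  have "{k, l} \<in> E" if "{p, q} \<in> E" "p \<le> k" "k < l" "l \<le> q" for p q k l
    using that
  proof (induction "q - p" arbitrary: p q rule: less_induct)
    case less
    consider "p = k" "q = l" | "p < k" | "l < q"
      using less.prems by linarith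
    then show ?case
    proof cases
      case 1
      then show ?thesis using less.prems by simp
    next
      case 2
      then have "{p + 1, q} \<in> E" using left less.prems by simp
      then show ?thesis using 2 less.prems by (intro less.hyps[of q "p + 1"]) auto
    next
      case 3
      then have "{p, q - 1} \<in> E" using right less.prems by simp
      then show ?thesis using 3 less.prems by (intro less.hyps[of "q - 1" p]) auto
    qed
  qed
  then show ?thesis unfolding convex_graph_def by blast
qed

lemma graph_on_edgeD:
  assumes "graph_on n E" and "{i, j} \<in> E"
  shows "i \<in> {1..n}" and "j \<in> {1..n}"
proof -
  have "{i, j} \<in> nsets {1..n} 2" using assms unfolding graph_on_def by blast
  then show "i \<in> {1..n}" "j \<in> {1..n}" by simp_all
qed

lemma clique_extends_to_maximal:
  assumes "C \<subseteq> {1..n}" and "clique C E"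
  obtains D where "D \<in> maximal_cliques n E" and "C \<subseteq> D"
proof -
  let ?A = "{D. D \<subseteq> {1..n} \<and> clique D E}"
  have "finite ?A" by (rule finite_subset[of _ "Pow {1..n}"]) auto
  then obtain D where "D \<in> ?A" "C \<subseteq> D" "\<forall>D'\<in>?A. D \<subseteq> D' \<longrightarrow> D = D'"
    using finite_has_maximal2[of ?A C] assms by auto
  then have "D \<in> maximal_cliques n E" unfolding maximal_cliques_def by blast
  then show ?thesis using that \<open>C \<subseteq> D\<close> by blast
qed

text \<open>An edge is a clique, hence it lies in some maximal clique; this is an interval, so it
  contains everything in between the ends of the edge.\<close>

lemma convex_graph_if_interval_labeled:
  assumes E: "graph_on n E" and "interval_labeled n E"
  shows "convex_graph E"
  unfolding convex_graph_def
proof (intro allI impI)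
  fix p q k l assume e: "{p, q} \<in> E" and kl: "p \<le> k" "k < l" "l \<le> q"
  have "{p, q} \<subseteq> {1..n}" using graph_on_edgeD[OF E e] by simp
  moreover have "clique {p, q} E" using e by (auto simp: clique_def insert_commute)
  ultimately obtain D where D: "D \<in> maximal_cliques n E" "{p, q} \<subseteq> D"
    by (rule clique_extends_to_maximal)
  obtain a b where "D = {a..b :: nat}"
    using D(1) assms(2) unfolding interval_labeled_def by blast
  then have "k \<in> D" "l \<in> D" using D(2) kl by auto
  moreover have "clique D E" using D(1) by (simp add: maximal_cliques_def)
  ultimately show "{k, l} \<in> E" using kl(2) by (auto simp: clique_def)
qed

text \<open>A path from \<open>i\<close> to \<open>i + 1\<close> has an edge crossing from \<open>[1, i]\<close> to \<open>[i + 1, n]\<close>, and convexity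
  shortens this edge to \<open>{i, i + 1}\<close>.\<close>

lemma consecutive_edge_if_connected:
  assumes "connected_graph n E" and cv: "convex_graph E" and i: "1 \<le> i" "i < n"
  shows "{i, i + 1} \<in> E"
proof (rule ccontr)
  assume no: "{i, i + 1} \<notin> E"
  have "(i, i + 1) \<in> {(x, y). {x, y} \<in> E}\<^sup>*"
    using assms(1) i unfolding connected_graph_def by simp
  moreover have "y \<le> i" if "(i, y) \<in> {(x, y). {x, y} \<in> E}\<^sup>*" for y
    using that
  proof induction
    case (step y z)
    show ?case
    proof (rule ccontr)
      assume "\<not> z \<le> i"
      then have "{i, i + 1} \<in> E" using step convex_graphD[OF cv, of y z i "i + 1"] by simp
      then show False using no by simp
    qed
  qed simp
  ultimately show False by force
qed

lemma connected_if_consecutive_edges: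
  assumes "\<And>i. 1 \<le> i \<Longrightarrow> i < n \<Longrightarrow> {i, i + 1} \<in> E"
  shows "connected_graph n E"
proof -
  let ?R = "{(x, y). {x, y} \<in> E}"
  have up: "(u, v) \<in> ?R\<^sup>*" if "u \<le> v" "1 \<le> u" "v \<le> n" for u v
    using that
  proof (induction v rule: dec_induct)
    case (step v)
    then have "(u, v) \<in> ?R\<^sup>*" "(v, Suc v) \<in> ?R" using assms[of v] by auto
    then show ?case by (rule rtrancl_into_rtrancl)
  qed simp
  have "sym (?R\<^sup>*)" by (rule sym_rtrancl) (auto simp: sym_def insert_commute)
  then show ?thesis
    unfolding connected_graph_def using up by (metis atLeastAtMost_iff linorder_linear symD)
qed

lemma closed_labeling_id_if_convex:
  assumes "convex_graph E"
  shows "closed_labeling n E id"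
proof -
  have "{v, w} \<in> E" if "u < v \<and> v < w \<or> w < v \<and> v < u" "{u, w} \<in> E" for u v w
    using that convex_graphD[OF assms, of u w v w] convex_graphD[OF assms, of w u w v]
    by (auto simp: insert_commute)
  then show ?thesis unfolding closed_labeling_def by auto
qed

lemma maximal_clique_is_interval:
  assumes cv: "convex_graph E" and "1 \<le> n" and C: "C \<in> maximal_cliques n E"
  shows "C \<noteq> {}" and "C = {Min C..Max C}"
proof -
  have sub: "C \<subseteq> {1..n}" and cl: "clique C E"
    and max: "\<And>D. D \<subseteq> {1..n} \<Longrightarrow> clique D E \<Longrightarrow> C \<subseteq> D \<Longrightarrow> D = C"
    using C unfolding maximal_cliques_def by auto
  have fin: "finite C" using sub finite_subset by blast
  show ne: "C \<noteq> {}"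
  proof
    assume "C = {}"
    moreover have "{1} = C"
      by (rule max) (use \<open>1 \<le> n\<close> \<open>C = {}\<close> in \<open>auto simp: clique_def\<close>)
    ultimately show False by simp
  qed
  have mm: "Min C \<in> C" "Max C \<in> C" using fin ne by simp_all
  have "{v, w} \<in> E" if "v \<in> {Min C..Max C}" "w \<in> {Min C..Max C}" "v < w" for v w
  proof -
    have "{Min C, Max C} \<in> E" using mm cl that by (auto simp: clique_def)
    then show ?thesis using convex_graphD[OF cv] that by auto
  qed
  then have "clique {Min C..Max C} E"
    unfolding clique_def by (metis insert_commute linorder_neqE_nat)
  moreover have "{Min C..Max C} \<subseteq> {1..n}" using mm sub by fastforce
  moreover have "C \<subseteq> {Min C..Max C}" using fin by auto
  ultimately show "C = {Min C..Max C}" using max by blast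
qed

text \<open>Two maximal cliques with the same left end are nested intervals, so they agree. Hence the
  maximal cliques can be listed by increasing left ends. The first one contains the vertex \<open>1\<close>.
  The last one ends in \<open>n\<close>, for otherwise it would be properly contained in any maximal clique
  through \<open>n\<close>; and it is not \<open>{n}\<close>, because \<open>{n - 1, n}\<close> is a larger clique.\<close>

lemma interval_labeled_if_convex:
  assumes "2 \<le> n" and cv: "convex_graph E" and last_edge: "{n - 1, n} \<in> E"
  shows "interval_labeled n E"
proof -
  let ?M = "maximal_cliques n E"
  have fin_M: "finite ?M"
    by (rule finite_subset[of _ "Pow {1..n}"]) (auto simp: maximal_cliques_def)
  have sub: "C \<subseteq> {1..n}" if "C \<in> ?M" for C
    using that by (simp add: maximal_cliques_def)
  have antichain: "C = D" if "C \<in> ?M" "D \<in> ?M" "C \<subseteq> D" for C D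
    using that by (auto simp: maximal_cliques_def)
  have ne: "C \<noteq> {}" and ivl: "C = {Min C..Max C}" if "C \<in> ?M" for C
    using maximal_clique_is_interval[OF cv _ that] assms(1) by auto
  have fin: "finite C" if "C \<in> ?M" for C
    using sub[OF that] finite_subset by blast
  have Min_in: "Min C \<in> C" and Max_in: "Max C \<in> C" if "C \<in> ?M" for C
    using fin[OF that] ne[OF that] by simp_all
  have inj: "inj_on Min ?M"
  proof (rule inj_onI)
    fix C D assume CD: "C \<in> ?M" "D \<in> ?M" "Min C = Min D"
    have "C \<subseteq> D \<or> D \<subseteq> C"
      using ivl[OF CD(1)] ivl[OF CD(2)] CD(3)
      by (metis atLeastatMost_subset_iff le_refl linorder_linear)
    then show "C = D" using antichain CD by blast
  qed
  define A where "A = Min ` ?M"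
  have "finite A" using fin_M A_def by simp
  then obtain h where h: "bij_betw h {..<card A} A" "strict_mono_on {..<card A} h"
    by (rule ex_bij_betw_strict_mono_card)
  define r where "r = card A"
  \<comment> \<open>The library enumerates from \<open>0\<close>, the maximal cliques are numbered from \<open>1\<close>.\<close>
  define a where "a i = h (i - 1)" for i
  define b where "b i = Max (the_inv_into ?M Min (a i))" for i
  have "(\<lambda>i. i - 1) ` {1..r} = {..<r}"
  proof -
    have "x \<in> (\<lambda>i. i - 1) ` {1..r}" if "x < r" for x
      using that by (intro image_eqI[of _ _ "Suc x"]) auto
    then show ?thesis by auto
  qed
  then have "h ` (\<lambda>i. i - 1) ` {1..r} = A"
    using h(1) by (simp add: r_def bij_betw_def)
  then have a_img: "a ` {1..r} = A"
    by (simp add: image_image a_def[abs_def])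
  have a_mono: "strict_mono_on {1..r} a"
    by (auto intro!: strict_mono_onI strict_mono_onD[OF h(2)] simp: a_def r_def)
  have a_le: "a i \<le> a j" if "1 \<le> i" "i \<le> j" "j \<le> r" for i j
    using that a_mono by (cases "i = j") (auto simp: strict_mono_on_def less_imp_le)
  have clique_of: "{a i..b i} \<in> ?M \<and> Min {a i..b i} = a i" if "i \<in> {1..r}" for i
  proof -
    have "a i \<in> Min ` ?M" using a_img that A_def by blast
    then have "the_inv_into ?M Min (a i) \<in> ?M" "Min (the_inv_into ?M Min (a i)) = a i"
      using inj by (auto simp: the_inv_into_into f_the_inv_into_f)
    then show ?thesis using ivl unfolding b_def by metis
  qed
  have index: "\<exists>i\<in>{1..r}. C = {a i..b i}" if C: "C \<in> ?M" for C
  proof -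
    obtain i where i: "i \<in> {1..r}" "a i = Min C" using a_img C A_def by (metis imageE imageI)
    then have "{a i..b i} = C" using clique_of[OF i(1)] inj C by (auto dest: inj_onD)
    then show ?thesis using i by blast
  qed
  have covers: "\<exists>i\<in>{1..r}. D \<subseteq> {a i..b i}" if "D \<subseteq> {1..n}" "clique D E" for D
    using clique_extends_to_maximal[OF that] index by metis
  have M_eq: "?M = (\<lambda>i. {a i..b i}) ` {1..r}"
    using clique_of index by blast
  have bounds: "1 \<le> a i \<and> a i \<le> b i \<and> b i \<le> n" if "i \<in> {1..r}" for i
    using ne[of "{a i..b i}"] sub[of "{a i..b i}"] clique_of[OF that] by auto
  obtain i1 where i1: "i1 \<in> {1..r}" "1 \<in> {a i1..b i1}"
    using covers[of "{1}"] assms(1) by (auto simp: clique_def)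
  then have r: "1 \<le> r" by simp
  have "a 1 = 1" using a_le[of 1 i1] i1 bounds[of 1] by auto
  have cl: "clique {n - 1, n} E" using last_edge by (auto simp: clique_def insert_commute)
  obtain i2 where i2: "i2 \<in> {1..r}" "{n - 1, n} \<subseteq> {a i2..b i2}"
  proof -
    have "{n - 1, n} \<subseteq> {1..n}" using assms(1) by auto
    then show ?thesis using covers[OF _ cl] that by blast
  qed
  have "{a r..b r} \<subseteq> {a i2..b i2}" using a_le[of i2 r] i2 bounds[of r] r by auto
  moreover have "{a r..b r} \<in> ?M" "{a i2..b i2} \<in> ?M" using clique_of i2(1) r by simp_all
  ultimately have "{a r..b r} = {a i2..b i2}" using antichain by blast
  then have "{n - 1, n} \<subseteq> {a r..b r}" using i2 by simp
  then have "a r < b r" "b r = n" using assms(1) bounds[of r] r by auto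
  then show ?thesis
    unfolding interval_labeled_def using r M_eq \<open>a 1 = 1\<close> a_mono by blast
qed

section \<open>The graph of a pair\<close>

lemma pair_graph_edgeE:
  assumes "{p, q} \<in> pair_graph E1 E2" and "p < q"
    and "graph_on m E1" and "graph_on n E2"
  obtains i j k l where "i < j" "k < l" "{i, j} \<in> E1" "{k, l} \<in> E2"
    "p = i + k - 1" "q = j + l - 2" "1 \<le> i" "j \<le> m" "1 \<le> k" "l \<le> n"
proof -
  obtain i j k l where e: "{p, q} = {i + k - 1, j + l - 2}"
    and ijkl: "i < j" "k < l" "{i, j} \<in> E1" "{k, l} \<in> E2"
    using assms(1) unfolding pair_graph_def by blast
  have b: "1 \<le> i" "j \<le> m" "1 \<le> k" "l \<le> n"
    using graph_on_edgeD[OF assms(3) ijkl(3)] graph_on_edgeD[OF assms(4) ijkl(4)] by auto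
  have "p = i + k - 1" "q = j + l - 2"
    using e assms(2) ijkl(1,2) b by (auto simp: doubleton_eq_iff)
  then show ?thesis using that ijkl b by blast
qed

lemma pair_graphI:
  "i < j \<Longrightarrow> k < l \<Longrightarrow> {i, j} \<in> E1 \<Longrightarrow> {k, l} \<in> E2 \<Longrightarrow> p = i + k - 1 \<Longrightarrow> q = j + l - 2
    \<Longrightarrow> {p, q} \<in> pair_graph E1 E2"
  unfolding pair_graph_def by blast

lemma graph_on_pair_graph:
  assumes "graph_on m E1" and "graph_on n E2"
  shows "graph_on (m + n - 2) (pair_graph E1 E2)"
  unfolding graph_on_def
proof
  fix e assume "e \<in> pair_graph E1 E2"
  then obtain i j k l where "e = {i + k - 1, j + l - 2}" "i < j" "k < l" "{i, j} \<in> E1" "{k, l} \<in> E2"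
    unfolding pair_graph_def by blast
  then show "e \<in> nsets {1..m + n - 2} 2"
    using graph_on_edgeD[OF assms(1), of i j] graph_on_edgeD[OF assms(2), of k l] by auto
qed

lemma convex_pair_graph:
  assumes "graph_on m E1" and "convex_graph E1" and "graph_on n E2" and "convex_graph E2"
  shows "convex_graph (pair_graph E1 E2)"
proof (rule convex_graphI_shorten)
  fix p q assume e: "{p, q} \<in> pair_graph E1 E2" and pq: "p + 1 < q"
  then obtain i j k l where ijkl: "i < j" "k < l" "{i, j} \<in> E1" "{k, l} \<in> E2"
    "p = i + k - 1" "q = j + l - 2" "1 \<le> i" "1 \<le> k"
    using pair_graph_edgeE[OF e _ assms(1,3)] by (metis add_lessD1)
  consider "i + 1 < j" | "k + 1 < l" using ijkl pq by linarith
  then have "{p + 1, q} \<in> pair_graph E1 E2 \<and> {p, q - 1} \<in> pair_graph E1 E2"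
  proof cases
    case 1
    then have "{i + 1, j} \<in> E1" "{i, j - 1} \<in> E1"
      using ijkl convex_graphD[OF assms(2), of i j] by auto
    then show ?thesis
      using 1 ijkl
      by (intro conjI pair_graphI[of "i + 1" j k l E1 E2 "p + 1" q]
          pair_graphI[of i "j - 1" k l E1 E2 p "q - 1"]) simp_all
  next
    case 2
    then have "{k + 1, l} \<in> E2" "{k, l - 1} \<in> E2"
      using ijkl convex_graphD[OF assms(4), of k l] by auto
    then show ?thesis
      using 2 ijkl
      by (intro conjI pair_graphI[of i j "k + 1" l E1 E2 "p + 1" q]
          pair_graphI[of i j k "l - 1" E1 E2 p "q - 1"]) simp_all
  qed
  then show "{p + 1, q} \<in> pair_graph E1 E2" "{p, q - 1} \<in> pair_graph E1 E2" by auto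
qed

lemma pair_graph_consecutive_edge:
  assumes c1: "\<And>i. 1 \<le> i \<Longrightarrow> i < m \<Longrightarrow> {i, i + 1} \<in> E1"
    and c2: "\<And>k. 1 \<le> k \<Longrightarrow> k < n \<Longrightarrow> {k, k + 1} \<in> E2"
    and "2 \<le> m" "2 \<le> n" "1 \<le> p" "p < m + n - 2"
  shows "{p, p + 1} \<in> pair_graph E1 E2"
proof -
  define i where "i = min p (m - 1)"
  have "{i, i + 1} \<in> E1" by (rule c1) (use assms(3-6) in \<open>auto simp: i_def\<close>)
  moreover have "{p + 1 - i, p + 1 - i + 1} \<in> E2"
    by (rule c2) (use assms(3-6) in \<open>auto simp: i_def\<close>)
  ultimately show ?thesis
    by (rule pair_graphI[rotated 2]) (use assms(3-6) in \<open>auto simp: i_def\<close>)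
qed

section \<open>The ideals\<close>

text \<open>Along the sequence \<open>x\<^sub>p x\<^sub>q\<^sub>+\<^sub>1\<close>, \<open>x\<^sub>p\<^sub>+\<^sub>1 x\<^sub>q\<close>, \<open>\<dots>\<close>, \<open>x\<^sub>u x\<^sub>v\<close> of monomials with constant index sum
  the successive differences are scroll binomials.\<close>

lemma telescoping_binomial:
  fixes I :: "'k::field mpoly set"
  assumes zero: "0 \<in> I" and add: "\<And>f g. f \<in> I \<Longrightarrow> g \<in> I \<Longrightarrow> f + g \<in> I"
    and step: "\<And>d. d < u - p \<Longrightarrow>
      X (p + d) * X (q - d + 1) - X (p + d + 1) * X (q - d) \<in> I"
    and u: "p \<le> u" "u \<le> q + 1" and uv: "u + v = p + q + 1"
  shows "X p * X (q + 1) - X u * X v \<in> I"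
proof -
  have "X p * X (q + 1) - X (p + d) * X (q + 1 - d) \<in> I" if "d \<le> u - p" for d
    using that
  proof (induction d)
    case 0
    show ?case using zero by simp
  next
    case (Suc d)
    have "q + 1 - d = q - d + 1" using Suc.prems u by linarith
    then have "X (p + d) * X (q + 1 - d) - X (p + Suc d) * X (q + 1 - Suc d) \<in> I"
      using step[of d] Suc.prems by simp
    from add[OF Suc.IH this] show ?case using Suc.prems by simp
  qed
  from this[of "u - p"] have "X p * X (q + 1) - X (p + (u - p)) * X (q + 1 - (u - p)) \<in> I"
    by simp
  moreover have "p + (u - p) = u" "q + 1 - (u - p) = v" using u uv by auto
  ultimately show ?thesis by simp
qed

text \<open>Since \<open>x\<^sub>u x\<^sub>v\<close> is symmetric, one may assume \<open>u \<le> v\<close>. Then the telescoping sum stops before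
  its two indices meet, so it only involves the scroll binomials of pairs \<open>s < t\<close>, which are the
  ones that come from edges.\<close>

lemma binomial_in_ideal:
  fixes I :: "'k::field mpoly set"
  assumes zero: "0 \<in> I" and add: "\<And>f g. f \<in> I \<Longrightarrow> g \<in> I \<Longrightarrow> f + g \<in> I"
    and scroll: "\<And>s t. p \<le> s \<Longrightarrow> s < t \<Longrightarrow> t \<le> q \<Longrightarrow> X s * X (t + 1) - X (s + 1) * X t \<in> I"
    and u: "p \<le> u" "p \<le> v" and uv: "u + v = p + q + 1"
  shows "X p * X (q + 1) - X u * X v \<in> I"
proof -
  have main: "X p * X (q + 1) - X u * X v \<in> I"
    if "u \<le> v" "p \<le> u" "u + v = p + q + 1" for u v
    by (rule telescoping_binomial[OF zero add])
      (use that in \<open>auto intro!: scroll[of "p + _" "q - _", simplified]\<close>)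
  show ?thesis
    using main[of u v] main[of v u] u uv by (cases "u \<le> v") (auto simp: mult.commute add.commute)
qed

definition hankel_minors :: "nat set set \<Rightarrow> nat set set \<Rightarrow> 'k::field mpoly set" where
  "hankel_minors E1 E2 = {hankel i k * hankel j l - hankel j k * hankel i l | i j k l.
          i < j \<and> k < l \<and> {i, j} \<in> E1 \<and> {k, l} \<in> E2}"

definition scroll_binomials :: "nat set set \<Rightarrow> 'k::field mpoly set" where
  "scroll_binomials E = {X p * X (q + 1) - X (p + 1) * X q | p q. p < q \<and> {p, q} \<in> E}"

lemma binomial_in_poly_ring:
  assumes "{p, q, u, v} \<subseteq> {1..N}"
  shows "X p * X q - X u * X v \<in> carrier (poly_ring N :: 'k::field mpoly ring)"
proof -
  interpret cring "poly_ring N :: 'k mpoly ring" by (rule cring_poly_ring)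
  let ?R = "poly_ring N :: 'k mpoly ring"
  have mon: "X i * X j \<in> carrier ?R" if "i \<in> {1..N}" "j \<in> {1..N}" for i j
    using that m_closed[of "X i" "X j"] by (simp add: poly_ring_sel X_in_poly_ring)
  have "(X u * X v) + (\<ominus>\<^bsub>?R\<^esub> (X u * X v)) = 0"
    using r_neg[OF mon[of u v]] assms by (simp add: poly_ring_sel)
  then have neg: "\<ominus>\<^bsub>?R\<^esub> (X u * X v) = - (X u * X v)"
    by (simp add: add_eq_0_iff)
  have "X p * X q \<oplus>\<^bsub>?R\<^esub> (\<ominus>\<^bsub>?R\<^esub> (X u * X v)) \<in> carrier ?R"
    using mon assms by (intro a_closed a_inv_closed) auto
  then show ?thesis unfolding neg by (simp add: poly_ring_sel)
qed

lemma poly_ring_ideal_closed: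
  assumes "ideal I (poly_ring N :: 'k::field mpoly ring)"
  shows "0 \<in> I" and "f \<in> I \<Longrightarrow> g \<in> I \<Longrightarrow> f + g \<in> I" and "f \<in> I \<Longrightarrow> g \<in> I \<Longrightarrow> f - g \<in> I"
proof -
  interpret ideal I "poly_ring N :: 'k mpoly ring" by (rule assms)
  let ?R = "poly_ring N :: 'k mpoly ring"
  show "0 \<in> I" using additive_subgroup.zero_closed[OF is_additive_subgroup] by (simp add: poly_ring_sel)
  show add: "f + g \<in> I" if "f \<in> I" "g \<in> I" for f g
    using additive_subgroup.a_closed[OF is_additive_subgroup that] by (simp add: poly_ring_sel)
  have "\<ominus>\<^bsub>?R\<^esub> g = - g" if "g \<in> I" for g
    using r_neg[of g] a_Hcarr[OF that] by (simp add: poly_ring_sel add_eq_0_iff)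
  then have "- g \<in> I" if "g \<in> I" for g
    using additive_subgroup.a_inv_closed[OF is_additive_subgroup that] that by metis
  then show "f - g \<in> I" if "f \<in> I" "g \<in> I" using add[of f "- g"] that by simp
qed

lemma minor_eq_binomial:
  assumes "1 \<le> i" "i < j" "1 \<le> k" "k < l"
  shows "hankel i k * hankel j l - hankel j k * hankel i l =
    (X (i + k - 1) * X (j + l - 2 + 1) - X (j + k - 1) * X (i + l - 1) :: 'k::field mpoly)"
proof -
  have "j + l - 1 = j + l - 2 + 1" using assms by linarith
  then show ?thesis by (simp only: hankel_def)
qed

lemma hankel_minors_in_poly_ring:
  assumes "graph_on m E1" and "graph_on n E2"
  shows "(hankel_minors E1 E2 :: 'k::field mpoly set) \<subseteq> carrier (poly_ring (m + n - 1))"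
proof
  fix f :: "'k mpoly" assume "f \<in> hankel_minors E1 E2"
  then obtain i j k l where "f = hankel i k * hankel j l - hankel j k * hankel i l"
    "i < j" "k < l" "{i, j} \<in> E1" "{k, l} \<in> E2"
    unfolding hankel_minors_def by blast
  then show "f \<in> carrier (poly_ring (m + n - 1))"
    using graph_on_edgeD[OF assms(1), of i j] graph_on_edgeD[OF assms(2), of k l]
    unfolding hankel_def by (auto intro!: binomial_in_poly_ring)
qed

lemma scroll_binomials_in_poly_ring:
  assumes "graph_on N E"
  shows "(scroll_binomials E :: 'k::field mpoly set) \<subseteq> carrier (poly_ring (N + 1))"
proof
  fix f :: "'k mpoly" assume "f \<in> scroll_binomials E"
  then obtain p q where "f = X p * X (q + 1) - X (p + 1) * X q" "p < q" "{p, q} \<in> E"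
    unfolding scroll_binomials_def by blast
  then show "f \<in> carrier (poly_ring (N + 1))"
    using graph_on_edgeD[OF assms, of p q] by (auto intro!: binomial_in_poly_ring)
qed

lemma scroll_binomialsI:
  "{s, t} \<in> E \<Longrightarrow> s < t \<Longrightarrow> X s * X (t + 1) - X (s + 1) * X t \<in> scroll_binomials E"
  unfolding scroll_binomials_def by blast

lemma hankel_minor_in_scroll_ideal:
  assumes "graph_on m E1" and "graph_on n E2" and cv: "convex_graph (pair_graph E1 E2)"
    and I: "ideal I (poly_ring N :: 'k::field mpoly ring)"
    and sub: "scroll_binomials (pair_graph E1 E2) \<subseteq> I"
  shows "hankel_minors E1 E2 \<subseteq> I"
proof
  fix f :: "'k mpoly" assume "f \<in> hankel_minors E1 E2"
  then obtain i j k l where f: "f = hankel i k * hankel j l - hankel j k * hankel i l"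
    and ijkl: "i < j" "k < l" "{i, j} \<in> E1" "{k, l} \<in> E2"
    unfolding hankel_minors_def by blast
  have b: "1 \<le> i" "1 \<le> k"
    using graph_on_edgeD[OF assms(1) ijkl(3)] graph_on_edgeD[OF assms(2) ijkl(4)] by auto
  let ?p = "i + k - 1" and ?q = "j + l - 2"
  have e: "{?p, ?q} \<in> pair_graph E1 E2" using ijkl by (rule pair_graphI) simp_all
  have "X ?p * X (?q + 1) - X (j + k - 1) * X (i + l - 1) \<in> I"
  proof (rule binomial_in_ideal[OF poly_ring_ideal_closed(1,2)[OF I]])
    fix s t assume "?p \<le> s" "s < t" "t \<le> ?q"
    then show "X s * X (t + 1) - X (s + 1) * X t \<in> I"
      using convex_graphD[OF cv e] scroll_binomialsI sub by blast
  qed (use ijkl b in auto)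
  then show "f \<in> I" unfolding f minor_eq_binomial[OF b(1) ijkl(1) b(2) ijkl(2)] .
qed

text \<open>The scroll binomial of \<open>{p, q}\<close> differs from a minor by \<open>x\<^sub>p\<^sub>+\<^sub>1 x\<^sub>q - x\<^sub>u x\<^sub>v\<close>, a telescoping sum
  of scroll binomials of pairs inside \<open>[p + 1, q - 1]\<close>, and these are covered by induction.\<close>

lemma scroll_binomial_in_hankel_ideal:
  assumes "graph_on m E1" and "graph_on n E2" and cv: "convex_graph (pair_graph E1 E2)"
    and I: "ideal I (poly_ring N :: 'k::field mpoly ring)"
    and sub: "hankel_minors E1 E2 \<subseteq> I"
  shows "{p, q} \<in> pair_graph E1 E2 \<Longrightarrow> p < q \<Longrightarrow> X p * X (q + 1) - X (p + 1) * X q \<in> I"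
proof (induction "q - p" arbitrary: p q rule: less_induct)
  case less
  obtain i j k l where ijkl: "i < j" "k < l" "{i, j} \<in> E1" "{k, l} \<in> E2"
    "p = i + k - 1" "q = j + l - 2" "1 \<le> i" "1 \<le> k"
    using pair_graph_edgeE[OF less.prems assms(1,2)] by metis
  have "hankel i k * hankel j l - hankel j k * hankel i l \<in> I"
    using ijkl sub unfolding hankel_minors_def by blast
  then have minor: "X p * X (q + 1) - X (j + k - 1) * X (i + l - 1) \<in> I"
    unfolding minor_eq_binomial[OF ijkl(7,1,8,2)] using ijkl(5,6) by simp
  have "X (p + 1) * X (q - 1 + 1) - X (j + k - 1) * X (i + l - 1) \<in> I"
  proof (rule binomial_in_ideal[OF poly_ring_ideal_closed(1,2)[OF I]])
    fix s t assume st: "p + 1 \<le> s" "s < t" "t \<le> q - 1"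
    then have "{s, t} \<in> pair_graph E1 E2" using convex_graphD[OF cv less.prems(1)] by simp
    then show "X s * X (t + 1) - X (s + 1) * X t \<in> I" using st by (intro less.hyps) auto
  qed (use ijkl in auto)
  then have "X (p + 1) * X q - X (j + k - 1) * X (i + l - 1) \<in> I" using less.prems by simp
  from poly_ring_ideal_closed(3)[OF I minor this] show ?case by simp
qed

theorem theorem1p1:
  fixes m n :: nat and E1 E2 :: "nat set set"
  assumes "m \<ge> 2" and "n \<ge> 2"
    and "graph_on m E1" and "connected_graph m E1" and "closed_graph m E1"
    and "graph_on n E2" and "connected_graph n E2" and "closed_graph n E2"
  shows "graph_on (m + n - 2) (pair_graph E1 E2) \<and>
         connected_graph (m + n - 2) (pair_graph E1 E2) \<and>
         closed_graph (m + n - 2) (pair_graph E1 E2) \<and>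
         (hankel_ideal m n E1 E2 :: 'k::field mpoly set) =
           scroll_ideal (m + n - 2) (pair_graph E1 E2)"
proof -
  let ?G = "pair_graph E1 E2" and ?N = "m + n - 2"
  have cv1: "convex_graph E1" and cv2: "convex_graph E2"
    using assms unfolding closed_graph_def by (auto intro: convex_graph_if_interval_labeled)
  have G: "graph_on ?N ?G" by (rule graph_on_pair_graph) fact+
  have cv: "convex_graph ?G" by (rule convex_pair_graph) fact+
  have consec: "{p, p + 1} \<in> ?G" if "1 \<le> p" "p < ?N" for p
    using that assms(1,2) consecutive_edge_if_connected[OF assms(4) cv1]
      consecutive_edge_if_connected[OF assms(7) cv2]
    by (intro pair_graph_consecutive_edge) auto
  have conn: "connected_graph ?N ?G" using consec by (rule connected_if_consecutive_edges)
  have "{?N - 1, ?N - 1 + 1} \<in> ?G" by (rule consec) (use assms(1,2) in auto)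
  moreover have "?N - 1 + 1 = ?N" using assms(1,2) by simp
  ultimately have "{?N - 1, ?N} \<in> ?G" by simp
  then have "interval_labeled ?N ?G"
    using assms(1,2) cv by (intro interval_labeled_if_convex) auto
  then have closed: "closed_graph ?N ?G"
    unfolding closed_graph_def using closed_labeling_id_if_convex[OF cv] by blast
  let ?R = "poly_ring (m + n - 1) :: 'k mpoly ring"
  interpret cring ?R by (rule cring_poly_ring)
  have "?N + 1 = m + n - 1" using assms(1,2) by simp
  then have hankel: "hankel_ideal m n E1 E2 = Idl\<^bsub>?R\<^esub> (hankel_minors E1 E2)"
    and scroll: "scroll_ideal ?N ?G = Idl\<^bsub>?R\<^esub> (scroll_binomials ?G)"
    and gens: "scroll_binomials ?G \<subseteq> carrier ?R"
    using scroll_binomials_in_poly_ring[OF G]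
    by (simp_all only: hankel_ideal_def hankel_minors_def scroll_ideal_def scroll_binomials_def)
  note minors = hankel_minors_in_poly_ring[OF assms(3,6)]
  have "Idl\<^bsub>?R\<^esub> (hankel_minors E1 E2) \<subseteq> Idl\<^bsub>?R\<^esub> (scroll_binomials ?G)"
    using genideal_ideal[OF gens] genideal_self[OF gens]
    by (intro genideal_minimal hankel_minor_in_scroll_ideal[OF assms(3,6) cv])
  moreover have "scroll_binomials ?G \<subseteq> Idl\<^bsub>?R\<^esub> (hankel_minors E1 E2)"
    using scroll_binomial_in_hankel_ideal[OF assms(3,6) cv genideal_ideal[OF minors]
        genideal_self[OF minors]]
    unfolding scroll_binomials_def by blast
  then have "Idl\<^bsub>?R\<^esub> (scroll_binomials ?G) \<subseteq> Idl\<^bsub>?R\<^esub> (hankel_minors E1 E2)"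
    by (intro genideal_minimal genideal_ideal minors)
  ultimately show ?thesis using G conn closed hankel scroll by blast
qed

end
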